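(* Let $K$ be a finite simplicial complex with nonempty vertex set and $s\ge1$. Then for every integer $r\ge1$ the number of $(r,s)$-colorings of $K$ is \[ \chi^s(K,r)=\sum_{T\in L^s(K)}\mu(\emptyset,T)\,r^{|\pi(T)|}, \] where $\mu$ is the Möbius function of the poset $L^s(K)$.
   Context: An $s$-simplex of $K$ is a face with $s+1$ vertices; $F^s(K)$ is the set of them. An $(r,s)$-coloring is a map $V(K)\to\{1,\dots,r\}$ with no monochrome $s$-simplex, and $\chi^s(K,r)$ is their number. For $S\subseteq F^s(K)$: the connected components of $S$ are the equivalence classes of the smallest equivalence relation on $S$ relating simplices with nonempty intersection; $V(S)=\bigcup S$; $S$ is closed if $\{\sigma\in F^s(K)\mid\sigma\subseteq V(S)\}=S$; $\pi(S)$ is the partition of $V(K)$ whose blocks are the vertex sets of the connected components of $S$ together with the singletons $\{v\}$, $v\in V(K)\setminus V(S)$. $L^s(K)$ is the set of subsets of $F^s(K)$ all of whose connected components are closed, ordered by inclusion (a lattice with least element $\emptyset$). *)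

theory Defs
  imports Main "HOL-Library.FuncSet"
begin

text \<open>Abstract simplicial complexes, given by their set of faces. Only nonempty subsets of
  faces are required to be faces, so both conventions for the empty face are admitted; every
  element of \<open>\<Union>K\<close> is automatically a vertex (\<open>{v} \<in> K\<close>).\<close>

definition simplicial_complex :: "'a set set \<Rightarrow> bool" where
  "simplicial_complex K \<longleftrightarrow>
     (\<forall>\<sigma>\<in>K. finite \<sigma> \<and> (\<forall>\<tau>. \<tau> \<subseteq> \<sigma> \<and> \<tau> \<noteq> {} \<longrightarrow> \<tau> \<in> K))"

definition vertices :: "'a set set \<Rightarrow> 'a set" where
  "vertices K = \<Union>K"

definition simplices :: "nat \<Rightarrow> 'a set set \<Rightarrow> 'a set set" where
  "simplices s K = {\<sigma> \<in> K. card \<sigma> = s + 1}"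

definition monochrome :: "('a \<Rightarrow> nat) \<Rightarrow> 'a set \<Rightarrow> bool" where
  "monochrome f \<sigma> \<longleftrightarrow> (\<exists>c. \<forall>v\<in>\<sigma>. f v = c)"

text \<open>Colorings are taken as extensional functions on the vertex set, so that they can be counted.\<close>

definition colorings :: "nat \<Rightarrow> nat \<Rightarrow> 'a set set \<Rightarrow> ('a \<Rightarrow> nat) set" where
  "colorings r s K = {f \<in> vertices K \<rightarrow>\<^sub>E {1..r}. \<not> (\<exists>\<sigma>\<in>simplices s K. monochrome f \<sigma>)}"

definition num_colorings :: "nat \<Rightarrow> 'a set set \<Rightarrow> nat \<Rightarrow> nat" where
  "num_colorings s K r = card (colorings r s K)"

definition connectedness :: "'a set set \<Rightarrow> ('a set \<times> 'a set) set" where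
  "connectedness S = \<Inter>{R. equiv S R \<and> (\<forall>\<sigma>\<in>S. \<forall>\<tau>\<in>S. \<sigma> \<inter> \<tau> \<noteq> {} \<longrightarrow> (\<sigma>, \<tau>) \<in> R)}"

definition conn_components :: "'a set set \<Rightarrow> 'a set set set" where
  "conn_components S = S // connectedness S"

definition closed_simplices :: "nat \<Rightarrow> 'a set set \<Rightarrow> 'a set set \<Rightarrow> bool" where
  "closed_simplices s K S \<longleftrightarrow> {\<sigma> \<in> simplices s K. \<sigma> \<subseteq> vertices S} = S"

definition block_partition :: "'a set set \<Rightarrow> 'a set set \<Rightarrow> 'a set set" where
  "block_partition K S = vertices ` conn_components S \<union> {{v} |v. v \<in> vertices K - vertices S}"

definition chromatic_lattice :: "nat \<Rightarrow> 'a set set \<Rightarrow> 'a set set set" where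
  "chromatic_lattice s K =
     {S. S \<subseteq> simplices s K \<and> (\<forall>C\<in>conn_components S. closed_simplices s K C)}"

text \<open>The Moebius function of a locally finite poset \<open>P\<close> with the order of the ambient type,
  extended by \<open>0\<close>; for \<open>x < y\<close> the recursion says that \<open>mobius P x z\<close> sums to \<open>0\<close> over
  the interval from \<open>x\<close> to \<open>y\<close> in \<open>P\<close>.\<close>

function mobius :: "'b::order set \<Rightarrow> 'b \<Rightarrow> 'b \<Rightarrow> int" where
  "mobius P x y =
     (if x \<in> P \<and> y \<in> P \<and> x \<le> y \<and> finite {z \<in> P. x \<le> z \<and> z \<le> y}
      then if x = y then 1 else - (\<Sum>z \<in> {z \<in> P. x \<le> z \<and> z < y}. mobius P x z)
      else 0)"
  by pat_completeness auto

termination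
proof (relation "measure (\<lambda>(P, x, y). card {z \<in> P. x \<le> z \<and> z \<le> y})")
  show "wf (measure (\<lambda>(P, x, y). card {z \<in> P. x \<le> z \<and> z \<le> y}))"
    by simp
next
  fix P and x y z :: "'b::order"
  assume a: "x \<in> P \<and> y \<in> P \<and> x \<le> y \<and> finite {z \<in> P. x \<le> z \<and> z \<le> y}"
    and z: "z \<in> {z \<in> P. x \<le> z \<and> z < y}"
  have "{w \<in> P. x \<le> w \<and> w \<le> z} \<subseteq> {w \<in> P. x \<le> w \<and> w \<le> y}"
    using z by auto
  moreover have "y \<in> {w \<in> P. x \<le> w \<and> w \<le> y}" "y \<notin> {w \<in> P. x \<le> w \<and> w \<le> z}"
    using a z by auto
  ultimately have "{w \<in> P. x \<le> w \<and> w \<le> z} \<subset> {w \<in> P. x \<le> w \<and> w \<le> y}"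
    by blast
  then show "((P, x, z), (P, x, y)) \<in> measure (\<lambda>(P, x, y). card {z \<in> P. x \<le> z \<and> z \<le> y})"
    using a by (simp add: psubset_card_mono)
qed

declare mobius.simps [simp del]

end

theory Submission
  imports Defs "HOL-Library.Disjoint_Sets"
begin

text \<open>The set of monochrome simplices of an arbitrary map \<open>f\<close> from the vertices to the colors is an
  element of the lattice, since connected monochrome simplices share their color. Hence the Moebius
  function sums over all \<open>T\<close> below it to \<open>1\<close> if \<open>f\<close> is a coloring and to \<open>0\<close> otherwise. Summing over
  all \<open>f\<close> and exchanging the sums, the coefficient of \<open>\<mu>(\<emptyset>, T)\<close> becomes the number of maps for which
  all simplices of \<open>T\<close> are monochrome; these are the maps constant on the blocks of \<open>\<pi>(T)\<close>.\<close>

section \<open>Moebius sums over intervals, and maps constant on the parts of a partition\<close>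

lemma sum_mobius_interval:
  assumes "x \<in> P" "y \<in> P" "x \<le> y" "finite {z \<in> P. x \<le> z \<and> z \<le> y}"
  shows "(\<Sum>z | z \<in> P \<and> x \<le> z \<and> z \<le> y. mobius P x z) = (if x = y then 1 else 0)"
proof -
  have split: "{z \<in> P. x \<le> z \<and> z \<le> y} = insert y {z \<in> P. x \<le> z \<and> z < y}"
    using assms by auto
  have fin: "finite {z \<in> P. x \<le> z \<and> z < y}"
    using assms(4) unfolding split by simp
  have *: "(\<Sum>z | z \<in> P \<and> x \<le> z \<and> z \<le> y. mobius P x z)
      = mobius P x y + (\<Sum>z | z \<in> P \<and> x \<le> z \<and> z < y. mobius P x z)"
    unfolding split using fin by simp
  show ?thesis
  proof (cases "x = y")
    case True
    \<comment> \<open>The index set is empty: no \<open>z\<close> satisfies \<open>x \<le> z\<close>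
      and \<open>z < x\<close>.\<close>
    then have "(\<Sum>z | z \<in> P \<and> x \<le> z \<and> z < y. mobius P x z) = 0"
      by (intro sum.neutral) auto
    moreover have "mobius P x y = 1"
      using assms True by (subst mobius.simps) simp
    ultimately show ?thesis using * True by simp
  next
    case False
    \<comment> \<open>The recursion defines the top term as minus the rest of the sum, so the total
      cancels.\<close>
    then have "mobius P x y = - (\<Sum>z | z \<in> P \<and> x \<le> z \<and> z < y. mobius P x z)"
      using assms by (subst mobius.simps) simp
    with * False show ?thesis by simp
  qed
qed

text \<open>Such a map amounts to a free choice of one value per part. Composing with
  \<open>blk\<close>, which sends a point to its part, and with \<open>rep\<close>, which picks a
  point of each part, gives mutually inverse bijections with
  \<open>P \<rightarrow>\<^sub>E B\<close>.\<close>

lemma card_constant_on_parts: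
  assumes part: "partition_on A P" and fin: "finite P"
  shows "card {f \<in> A \<rightarrow>\<^sub>E B. \<forall>p\<in>P. \<forall>x\<in>p. \<forall>y\<in>p. f x = f y} = card B ^ card P"
proof -
  define blk where "blk x = (THE p. p \<in> P \<and> x \<in> p)" for x
  define rep where "rep p = (SOME x. x \<in> p)" for p :: "'a set"
  have blk: "blk x = p" if "p \<in> P" "x \<in> p" for x p
    unfolding blk_def using that part
    by (intro the_equality) (auto simp: partition_on_def disjoint_def)
  have rep: "rep p \<in> p" if "p \<in> P" for p
    using that part unfolding rep_def partition_on_def by (metis some_in_eq)
  have A: "x \<in> A \<longleftrightarrow> (\<exists>p\<in>P. x \<in> p)" for x
    using part by (auto simp: partition_on_def)
  have "bij_betw (\<lambda>g. restrict (g \<circ> blk) A) (P \<rightarrow>\<^sub>E B)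
    {f \<in> A \<rightarrow>\<^sub>E B. \<forall>p\<in>P. \<forall>x\<in>p. \<forall>y\<in>p. f x = f y}"
  proof (rule bij_betw_byWitness[where f' = "\<lambda>f. restrict (f \<circ> rep) P"])
    show "\<forall>g\<in>P \<rightarrow>\<^sub>E B. restrict (restrict (g \<circ> blk) A \<circ> rep) P = g"
    proof
      fix g assume g: "g \<in> P \<rightarrow>\<^sub>E B"
      show "restrict (restrict (g \<circ> blk) A \<circ> rep) P = g"
      proof
        fix p show "restrict (restrict (g \<circ> blk) A \<circ> rep) P p = g p"
        proof (cases "p \<in> P")
          case True
          moreover have "rep p \<in> A" using True rep A by blast
          ultimately show ?thesis using blk[OF True rep[OF True]] by simp
        next
          case False
          \<comment> \<open>Outside \<open>P\<close> both sides are \<open>undefined\<close>, the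
            default value of extensional functions.\<close>
          with PiE_arb[OF g] show ?thesis by simp
        qed
      qed
    qed
    show "\<forall>f\<in>{f \<in> A \<rightarrow>\<^sub>E B. \<forall>p\<in>P. \<forall>x\<in>p. \<forall>y\<in>p. f x = f y}.
        restrict (restrict (f \<circ> rep) P \<circ> blk) A = f"
    proof
      fix f assume f: "f \<in> {f \<in> A \<rightarrow>\<^sub>E B. \<forall>p\<in>P. \<forall>x\<in>p. \<forall>y\<in>p. f x = f y}"
      show "restrict (restrict (f \<circ> rep) P \<circ> blk) A = f"
      proof
        fix x
        show "restrict (restrict (f \<circ> rep) P \<circ> blk) A x = f x"
        proof (cases "x \<in> A")
          case True
          then obtain p where p: "p \<in> P" "x \<in> p" using A by blast
          then have "f (rep p) = f x" using f rep by blast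
          with p True blk[OF p] show ?thesis by simp
        next
          case False
          then have "f x = undefined" using f PiE_arb by blast
          with False show ?thesis by simp
        qed
      qed
    qed
    show "(\<lambda>g. restrict (g \<circ> blk) A) ` (P \<rightarrow>\<^sub>E B)
        \<subseteq> {f \<in> A \<rightarrow>\<^sub>E B. \<forall>p\<in>P. \<forall>x\<in>p. \<forall>y\<in>p. f x = f y}"
    proof (intro image_subsetI CollectI conjI ballI)
      fix g assume g: "g \<in> P \<rightarrow>\<^sub>E B"
      have "g (blk x) \<in> B" if "x \<in> A" for x
        using that g blk unfolding A by fastforce
      then show "restrict (g \<circ> blk) A \<in> A \<rightarrow>\<^sub>E B" by simp
      fix p x y assume p: "p \<in> P" "x \<in> p" "y \<in> p"
      then have "x \<in> A" "y \<in> A" using A by blast+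
      with p show "restrict (g \<circ> blk) A x = restrict (g \<circ> blk) A y"
        using blk[OF p(1,2)] blk[OF p(1,3)] by simp
    qed
    show "(\<lambda>f. restrict (f \<circ> rep) P) ` {f \<in> A \<rightarrow>\<^sub>E B. \<forall>p\<in>P. \<forall>x\<in>p. \<forall>y\<in>p. f x = f y} \<subseteq> P \<rightarrow>\<^sub>E B"
    proof (rule image_subsetI)
      fix f assume f: "f \<in> {f \<in> A \<rightarrow>\<^sub>E B. \<forall>p\<in>P. \<forall>x\<in>p. \<forall>y\<in>p. f x = f y}"
      have "f (rep p) \<in> B" if "p \<in> P" for p
        using that f rep A by blast
      then show "restrict (f \<circ> rep) P \<in> P \<rightarrow>\<^sub>E B" by simp
    qed
  qed
  from bij_betw_same_card[OF this] show ?thesis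
    using card_PiE[OF fin, of "\<lambda>_. B"] by simp
qed

section \<open>Connected components and the partition of the vertices\<close>

lemma equiv_connectedness: "equiv S (connectedness S)"
proof -
  let ?F = "{R. equiv S R \<and> (\<forall>\<sigma>\<in>S. \<forall>\<tau>\<in>S. \<sigma> \<inter> \<tau> \<noteq> {} \<longrightarrow> (\<sigma>, \<tau>) \<in> R)}"
  \<comment> \<open>The total relation keeps the intersection from ranging over an empty family and
    confines it to \<open>S \<times> S\<close>.\<close>
  have "S \<times> S \<in> ?F"
    by (auto simp: equiv_def refl_on_def sym_def trans_def)
  then have sub: "\<Inter>?F \<subseteq> S \<times> S" by blast
  show ?thesis
    unfolding connectedness_def
  proof (rule equivI)
    show "\<Inter>?F \<subseteq> S \<times> S" by (rule sub)
    show "refl_on S (\<Inter>?F)" by (auto simp: refl_on_def equiv_def)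
    show "sym (\<Inter>?F)" by (rule symI) (auto simp: equiv_def dest: symD)
    show "trans (\<Inter>?F)" by (rule transI) (auto simp: equiv_def dest: transD)
  qed
qed

lemma connectedness_intersecting:
  "\<sigma> \<in> S \<Longrightarrow> \<tau> \<in> S \<Longrightarrow> \<sigma> \<inter> \<tau> \<noteq> {} \<Longrightarrow> (\<sigma>, \<tau>) \<in> connectedness S"
  by (auto simp: connectedness_def)

text \<open>Serves as an induction principle: an invariant shared by intersecting simplices is
  shared by all simplices of a component.\<close>

lemma connectedness_least:
  assumes "equiv S R" "\<And>\<sigma> \<tau>. \<sigma> \<in> S \<Longrightarrow> \<tau> \<in> S \<Longrightarrow> \<sigma> \<inter> \<tau> \<noteq> {} \<Longrightarrow> (\<sigma>, \<tau>) \<in> R"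
  shows "connectedness S \<subseteq> R"
  using assms by (auto simp: connectedness_def)

lemma Union_conn_components: "\<Union>(conn_components S) = S"
  unfolding conn_components_def by (rule Union_quotient[OF equiv_connectedness])

text \<open>Intersecting simplices are related, and related elements have the same equivalence
  class. Hence distinct components have disjoint vertex sets.\<close>

lemma conn_components_eq_if_intersecting:
  assumes "C \<in> conn_components S" "D \<in> conn_components S"
    and "\<sigma> \<in> C" "\<tau> \<in> D" "\<sigma> \<inter> \<tau> \<noteq> {}"
  shows "C = D"
proof -
  have "\<sigma> \<in> S" "\<tau> \<in> S"
    using assms Union_conn_components by blast+
  then have "(\<sigma>, \<tau>) \<in> connectedness S"
    using assms(5) by (rule connectedness_intersecting)
  then show ?thesis
    using quotient_eqI[OF equiv_connectedness] assms(1-4) unfolding conn_components_def by blast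
qed

text \<open>Components supply disjoint blocks covering \<open>vertices S\<close>, and singletons
  cover the other vertices. A component is a nonempty set of nonempty simplices, so no block is
  empty.\<close>

lemma partition_on_block_partition:
  assumes "S \<subseteq> K" "{} \<notin> S"
  shows "partition_on (vertices K) (block_partition K S)"
proof (rule partition_onI)
  have "\<Union>(vertices ` conn_components S) = vertices S"
    using Union_conn_components[of S] by (auto simp: vertices_def)
  moreover have "vertices S \<subseteq> vertices K"
    using assms(1) by (auto simp: vertices_def)
  moreover have "\<Union>{{v} |v. v \<in> vertices K - vertices S} = vertices K - vertices S"
    by blast
  ultimately show "\<Union>(block_partition K S) = vertices K"
    unfolding block_partition_def Union_Un_distrib by auto
next
  fix p q assume pq: "p \<in> block_partition K S" "q \<in> block_partition K S" "p \<noteq> q"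
  have sub: "vertices C \<subseteq> vertices S" if "C \<in> conn_components S" for C
    using that Union_conn_components[of S] by (auto simp: vertices_def)
  have disj: "vertices C \<inter> vertices D = {}"
    if "C \<in> conn_components S" "D \<in> conn_components S" "vertices C \<noteq> vertices D" for C D
  proof (rule ccontr)
    assume "vertices C \<inter> vertices D \<noteq> {}"
    then obtain \<sigma> \<tau> where "\<sigma> \<in> C" "\<tau> \<in> D" "\<sigma> \<inter> \<tau> \<noteq> {}"
      unfolding vertices_def by blast
    with that conn_components_eq_if_intersecting show False by metis
  qed
  show "disjnt p q"
    using pq(1,2) unfolding block_partition_def
  proof (elim UnE imageE)
    fix C D assume "C \<in> conn_components S" "D \<in> conn_components S" "p = vertices C" "q = vertices D"
    with disj pq(3) show ?thesis unfolding disjnt_def by simp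
  \<comment> \<open>The cases with a singleton: it lies outside \<open>vertices S\<close>, which
    contains all blocks of components, and distinct singletons are disjoint.\<close>
  qed (use sub pq(3) in \<open>auto simp: disjnt_def\<close>)
next
  have "vertices C \<noteq> {}" if "C \<in> conn_components S" for C
  proof -
    have "C \<noteq> {}"
      using that in_quotient_imp_non_empty[OF equiv_connectedness]
      unfolding conn_components_def by blast
    moreover have "{} \<notin> C"
      using that Union_conn_components[of S] assms(2) by blast
    ultimately obtain \<sigma> where "\<sigma> \<in> C" "\<sigma> \<noteq> {}" by (metis ex_in_conv)
    then show ?thesis by (auto simp: vertices_def)
  qed
  then show "{} \<notin> block_partition K S"
    unfolding block_partition_def by auto
qed

section \<open>Monochrome simplices and the lattice\<close>

lemma constant_on_conn_component:
  assumes mono: "\<And>\<sigma>. \<sigma> \<in> S \<Longrightarrow> monochrome f \<sigma>" and ne: "{} \<notin> S"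
    and C: "C \<in> conn_components S" and xy: "x \<in> vertices C" "y \<in> vertices C"
  shows "f x = f y"
proof -
  obtain \<sigma> \<tau> where st: "\<sigma> \<in> C" "x \<in> \<sigma>" "\<tau> \<in> C" "y \<in> \<tau>"
    using xy unfolding vertices_def by blast
  have S: "\<sigma> \<in> S" "\<tau> \<in> S"
    using C st Union_conn_components by blast+
  have "(\<sigma>, \<tau>) \<in> connectedness S"
    using C st quotient_eq_iff[OF equiv_connectedness] unfolding conn_components_def by metis
  \<comment> \<open>Having the same color is expressed as having the same image under
    \<open>f\<close>, which is visibly an equivalence relation; a common vertex forces both images
    to be the same singleton.\<close>
  moreover have "connectedness S \<subseteq> {(\<sigma>, \<tau>) \<in> S \<times> S. f ` \<sigma> = f ` \<tau>}"
  proof (rule connectedness_least)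
    show "equiv S {(\<sigma>, \<tau>) \<in> S \<times> S. f ` \<sigma> = f ` \<tau>}"
      by (auto simp: equiv_def refl_on_def sym_def trans_def)
  next
    fix \<sigma> \<tau> assume *: "\<sigma> \<in> S" "\<tau> \<in> S" "\<sigma> \<inter> \<tau> \<noteq> {}"
    then obtain v where v: "v \<in> \<sigma>" "v \<in> \<tau>" by blast
    have "f ` \<sigma> = {f v}" "f ` \<tau> = {f v}"
      using mono[OF *(1)] mono[OF *(2)] v unfolding monochrome_def by auto
    then show "(\<sigma>, \<tau>) \<in> {(\<sigma>, \<tau>) \<in> S \<times> S. f ` \<sigma> = f ` \<tau>}"
      using * by simp
  qed
  ultimately have "f ` \<sigma> = f ` \<tau>" by blast
  then have "f x \<in> f ` \<tau>" using st by blast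
  then show ?thesis
    using mono[OF S(2)] st unfolding monochrome_def by auto
qed

text \<open>Every simplex of \<open>S\<close> lies in the block of its component, and singleton
  blocks impose no condition. This brings the coloring condition into the form counted by
  \<open>card_constant_on_parts\<close>.\<close>

lemma monochrome_iff_constant_on_blocks:
  assumes "{} \<notin> S"
  shows "(\<forall>\<sigma>\<in>S. monochrome f \<sigma>) \<longleftrightarrow> (\<forall>p\<in>block_partition K S. \<forall>x\<in>p. \<forall>y\<in>p. f x = f y)"
proof
  assume "\<forall>\<sigma>\<in>S. monochrome f \<sigma>"
  then show "\<forall>p\<in>block_partition K S. \<forall>x\<in>p. \<forall>y\<in>p. f x = f y"
    using constant_on_conn_component[of S f] assms unfolding block_partition_def by blast
next
  assume const: "\<forall>p\<in>block_partition K S. \<forall>x\<in>p. \<forall>y\<in>p. f x = f y"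
  show "\<forall>\<sigma>\<in>S. monochrome f \<sigma>"
  proof
    fix \<sigma> assume "\<sigma> \<in> S"
    then obtain C where C: "C \<in> conn_components S" "\<sigma> \<in> C"
      using Union_conn_components by blast
    then have "\<forall>x\<in>\<sigma>. \<forall>y\<in>\<sigma>. f x = f y"
      using const unfolding block_partition_def vertices_def by blast
    then show "monochrome f \<sigma>" unfolding monochrome_def by metis
  qed
qed

lemma empty_notin_simplices: "{} \<notin> simplices s K"
  by (simp add: simplices_def)

text \<open>Since \<open>f\<close> is constant on the vertices of a component \<open>C\<close>,
  every simplex on these vertices is monochrome too. It meets a simplex of \<open>C\<close>, so its
  own component is \<open>C\<close>.\<close>

lemma monochrome_simplices_in_chromatic_lattice:
  "{\<sigma> \<in> simplices s K. monochrome f \<sigma>} \<in> chromatic_lattice s K" (is "?M \<in> _")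
proof -
  have ne: "{} \<notin> ?M" using empty_notin_simplices by blast
  have "closed_simplices s K C" if C: "C \<in> conn_components ?M" for C
    unfolding closed_simplices_def
  proof (intro equalityI subsetI)
    fix \<sigma> assume "\<sigma> \<in> {\<sigma> \<in> simplices s K. \<sigma> \<subseteq> vertices C}"
    then have \<sigma>: "\<sigma> \<in> simplices s K" "\<sigma> \<subseteq> vertices C" by auto
    have "f x = f y" if "x \<in> \<sigma>" "y \<in> \<sigma>" for x y
      using constant_on_conn_component[OF _ ne C] that \<sigma> by blast
    then have "monochrome f \<sigma>" unfolding monochrome_def by metis
    then obtain D where D: "D \<in> conn_components ?M" "\<sigma> \<in> D"
      using \<sigma> Union_conn_components[of ?M] by blast
    \<comment> \<open>A simplex has \<open>s + 1\<close> vertices, hence at least one, and that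
      vertex lies in some simplex of \<open>C\<close>.\<close>
    have "\<sigma> \<noteq> {}" using \<sigma> empty_notin_simplices by blast
    then obtain \<tau> where "\<tau> \<in> C" "\<tau> \<inter> \<sigma> \<noteq> {}"
      using \<sigma> unfolding vertices_def by blast
    then show "\<sigma> \<in> C"
      using conn_components_eq_if_intersecting[OF C D(1) _ D(2)] D(2) by blast
  next
    fix \<sigma> assume "\<sigma> \<in> C"
    then show "\<sigma> \<in> {\<sigma> \<in> simplices s K. \<sigma> \<subseteq> vertices C}"
    proof -
      have "C \<subseteq> ?M" using C Union_conn_components[of ?M] by (metis Union_upper)
      with \<open>\<sigma> \<in> C\<close> show ?thesis by (auto simp: vertices_def)
    qed
  qed
  then show ?thesis unfolding chromatic_lattice_def by blast
qed

section \<open>Counting maps and colorings\<close>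

lemma card_monochrome_maps:
  assumes "finite (vertices K)" "T \<subseteq> simplices s K"
  shows "card {f \<in> vertices K \<rightarrow>\<^sub>E {1..r}. \<forall>\<sigma>\<in>T. monochrome f \<sigma>} = r ^ card (block_partition K T)"
proof -
  have ne: "{} \<notin> T" and sub: "T \<subseteq> K"
    using assms(2) empty_notin_simplices by (auto simp: simplices_def)
  have part: "partition_on (vertices K) (block_partition K T)"
    using sub ne by (rule partition_on_block_partition)
  show ?thesis
    unfolding monochrome_iff_constant_on_blocks[OF ne, of _ K]
    using card_constant_on_parts[OF part finite_elements[OF assms(1) part], of "{1..r}"] by simp
qed

theorem theorem2p24:
  fixes K :: "'a set set" and s r :: nat
  assumes "simplicial_complex K" and "finite K" and "vertices K \<noteq> {}"
    and "s \<ge> 1" and "r \<ge> 1"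
  shows "int (num_colorings s K r) =
    (\<Sum>T \<in> chromatic_lattice s K.
       mobius (chromatic_lattice s K) {} T * int r ^ card (block_partition K T))"
proof -
  define L where "L = chromatic_lattice s K"
  define F where "F = vertices K \<rightarrow>\<^sub>E {1..r}"
  define M where "M f = {\<sigma> \<in> simplices s K. monochrome f \<sigma>}" for f
  have finV: "finite (vertices K)"
    using assms(1,2) unfolding vertices_def simplicial_complex_def by blast
  have finF: "finite F"
    unfolding F_def using finV by (intro finite_PiE) auto
  have L_sub: "T \<subseteq> simplices s K" if "T \<in> L" for T
    using that unfolding L_def chromatic_lattice_def by blast
  have "L \<subseteq> Pow K"
    using L_sub unfolding simplices_def by blast
  then have finL: "finite L"
    using assms(2) by (meson finite_Pow_iff finite_subset)
  \<comment> \<open>The empty set has no components, so closedness holds vacuously; it is the lower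
    end of all intervals below.\<close>
  have emptyL: "{} \<in> L"
    unfolding L_def chromatic_lattice_def conn_components_def by simp
  have M_in_L: "M f \<in> L" for f
    unfolding M_def L_def by (rule monochrome_simplices_in_chromatic_lattice)
  have "colorings r s K = {f \<in> F. M f = {}}"
    unfolding colorings_def F_def M_def by blast
  \<comment> \<open>The equation is oriented as \<open>{} = M f\<close> to match the right-hand side
    of \<open>sum_mobius_interval\<close> for the interval from \<open>{}\<close> to
    \<open>M f\<close>.\<close>
  then have "int (num_colorings s K r) = (\<Sum>f\<in>F. if {} = M f then 1 else 0)"
    unfolding num_colorings_def using finF by (simp add: sum.If_cases Int_def eq_commute)
  also have "\<dots> = (\<Sum>f\<in>F. \<Sum>T | T \<in> L \<and> T \<subseteq> M f. mobius L {} T)"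
    using sum_mobius_interval[OF emptyL M_in_L] finL by simp
  also have "\<dots> = (\<Sum>T\<in>L. \<Sum>f | f \<in> F \<and> T \<subseteq> M f. mobius L {} T)"
    by (rule sum.swap_restrict[OF finF finL])
  also have "\<dots> = (\<Sum>T\<in>L. mobius L {} T * int r ^ card (block_partition K T))"
  proof (rule sum.cong[OF refl])
    fix T assume "T \<in> L"
    then have T: "T \<subseteq> simplices s K" by (rule L_sub)
    \<comment> \<open>The inner summand does not depend on \<open>f\<close>, so only the number of
      maps with \<open>T \<subseteq> M f\<close> matters.\<close>
    then have "{f \<in> F. T \<subseteq> M f} = {f \<in> vertices K \<rightarrow>\<^sub>E {1..r}. \<forall>\<sigma>\<in>T. monochrome f \<sigma>}"
      unfolding F_def M_def by blast
    then show "(\<Sum>f | f \<in> F \<and> T \<subseteq> M f. mobius L {} T)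
        = mobius L {} T * int r ^ card (block_partition K T)"
      using card_monochrome_maps[OF finV T, of r] by simp
  qed
  finally show ?thesis unfolding L_def .
qed

end
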